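(* Let $A \in \{0,1\}^{n \times n}$ be the adjacency matrix of a connected undirected graph. Then the matrix $A + \mathrm{Id}$ has support, and the matrices $W, Z \in \mathbb{R}^{2n\times 2n}$ defined by $$W = Z = 2\begin{bmatrix} \mathrm{Id} & -SK(A+\mathrm{Id}) \\ -SK(A+\mathrm{Id}) & \mathrm{Id} \end{bmatrix}$$ are symmetric positive semidefinite and satisfy (a) $Z \succeq W$; (b) $\operatorname{null}(W) = \operatorname{span}(\mathbf{1})$; (c) $\operatorname{diag}(Z) = 2\cdot\mathbf{1}$, i.e. $Z_{ii}=2$ for all $i$; (d) $\mathbf{1}^T Z \mathbf{1} = 0$; and $Z$ and $W$ 2-Block adhere to the sparsity structure of $G(A)$.
   Context: Notation: $\mathrm{Id}$ is the $n \times n$ identity matrix; $\mathbf{1}$ is the all-ones vector; $Z \succeq W$ means that $Z - W$ is symmetric positive semidefinite; $\operatorname{null}$ denotes the null space (kernel). $G(A)$ is the unweighted undirected graph on $\{1,\dots,n\}$ with (symmetric) adjacency matrix $A$. Support: a nonnegative square matrix $C \in \mathbb{R}_+^{n\times n}$ is viewed as the weighted bi-adjacency matrix of a bipartite graph on two sets of $n$ nodes, with an edge between node $i$ of the first set and node $j$ of the second set exactly when $C_{ij} > 0$. $C$ has support if this bipartite graph has a perfect matching (equivalently, there is a permutation $\sigma$ of $\{1,\dots,n\}$ with $C_{i\sigma(i)} > 0$ for all $i$). Sinkhorn-Knopp algorithm (doubly stochastic case): starting from a nonnegative square matrix $C$, alternately (i) scale each row so that it sums to one, and (ii) scale each column so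 that it sums to one, and repeat. $SK(C)$ denotes the limit of the resulting sequence of matrices when it exists. A theorem of Sinkhorn and Knopp states that the algorithm converges if and only if $C$ has support, so $SK(C)$ is well defined for a matrix with support. 2-Block adherence: let $A \in \{0,1\}^{n\times n}$ be an adjacency matrix and let $Z, W \in \mathbb{R}^{2n\times 2n}$ be symmetric, with $Z$ of the 2-Block form $$Z = 2\begin{bmatrix} \mathrm{Id} & -B^T \\ -B & \mathrm{Id}\end{bmatrix}, \qquad B \in \mathbb{R}^{n\times n}.$$ $Z$ and $W$ 2-Block adhere to the sparsity structure of $G(A)$ if for all $i \neq j$ in $\{1,\dots,n\}$ with $A_{ij} = 0$ one has $B_{ij} = B_{ji} = 0$ and $W_{ij} = W_{j+n,\,i} = W_{i+n,\,j} = W_{i+n,\,j+n} = 0$. *)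

theory Defs
  imports "HOL-Analysis.Analysis" "Graph_Theory.Digraph_Component"
begin

text \<open>
  Nodes \<open>1, \<dots>, n\<close> are the elements of a finite type \<open>'n\<close>, and the index set of a
  \<open>2n \<times> 2n\<close> matrix is \<open>'n + 'n\<close>: \<open>Inl i\<close> stands for the index \<open>i\<close> and
  \<open>Inr i\<close> for the index \<open>i + n\<close>.
\<close>

definition adjacency_graph :: "real^'n^'n \<Rightarrow> ('n::finite, 'n \<times> 'n) pre_digraph" where
  "adjacency_graph A =
    \<lparr>verts = UNIV, arcs = {(i, j). A $ i $ j = 1}, tail = fst, head = snd\<rparr>"

text \<open>
  The qualified name distinguishes connectedness of graphs from that of topological spaces.
\<close>

definition connected_adjacency_matrix :: "real^'n^'n \<Rightarrow> bool" where
  "connected_adjacency_matrix A \<longleftrightarrow>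
    (\<forall>i j. A $ i $ j \<in> {0, 1}) \<and> transpose A = A \<and>
    Digraph_Component.connected (adjacency_graph A)"

text \<open>
  The two sides of the bipartite graph are two copies of \<open>'n\<close>, so that an edge is an ordered
  pair \<open>(i, j)\<close> with \<open>i\<close> in the first copy and \<open>j\<close> in the second; \<open>M\<close> below is a
  perfect matching.
\<close>

definition has_support :: "real^'n^'n \<Rightarrow> bool" where
  "has_support C \<longleftrightarrow>
    (\<exists>M \<subseteq> {(i, j). C $ i $ j > 0}.
      (\<forall>i. \<exists>!j. (i, j) \<in> M) \<and> (\<forall>j. \<exists>!i. (i, j) \<in> M))"

definition scale_rows :: "real^'n^'n \<Rightarrow> real^'n^'n" where
  "scale_rows C = (\<chi> i j. C $ i $ j / (\<Sum>k\<in>UNIV. C $ i $ k))"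

definition scale_cols :: "real^'n^'n \<Rightarrow> real^'n^'n" where
  "scale_cols C = (\<chi> i j. C $ i $ j / (\<Sum>k\<in>UNIV. C $ k $ j))"

text \<open>Every single scaling counts as one term of the sequence.\<close>

fun sinkhorn_knopp_seq :: "real^'n^'n \<Rightarrow> nat \<Rightarrow> real^'n^'n" where
  "sinkhorn_knopp_seq C 0 = C"
| "sinkhorn_knopp_seq C (Suc k) =
    (if even k then scale_rows else scale_cols) (sinkhorn_knopp_seq C k)"

text \<open>Only meaningful if the sequence is convergent; otherwise the value is unspecified.\<close>

definition SK :: "real^'n^'n \<Rightarrow> real^'n^'n" where
  "SK C = lim (sinkhorn_knopp_seq C)"

definition block_matrix ::
  "real^'n^'n \<Rightarrow> real^'n^'n \<Rightarrow> real^'n^'n \<Rightarrow> real^'n^'n \<Rightarrow> real^('n::finite + 'n)^('n + 'n)" where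
  "block_matrix P Q R S = (\<chi> a b.
    case (a, b) of
      (Inl i, Inl j) \<Rightarrow> P $ i $ j
    | (Inl i, Inr j) \<Rightarrow> Q $ i $ j
    | (Inr i, Inl j) \<Rightarrow> R $ i $ j
    | (Inr i, Inr j) \<Rightarrow> S $ i $ j)"

definition pos_semidef :: "real^'m^'m \<Rightarrow> bool" where
  "pos_semidef M \<longleftrightarrow> transpose M = M \<and> (\<forall>x. 0 \<le> x \<bullet> (M *v x))"

definition loewner_ge :: "real^'m^'m \<Rightarrow> real^'m^'m \<Rightarrow> bool" (infix \<open>\<succeq>\<close> 50) where
  "Z \<succeq> W \<longleftrightarrow> pos_semidef (Z - W)"

definition null_space :: "real^'m^'m \<Rightarrow> (real^'m) set" where
  "null_space M = {x. M *v x = 0}"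

definition two_block_adhere ::
  "real^'n^'n \<Rightarrow> real^('n::finite + 'n)^('n + 'n) \<Rightarrow> real^('n + 'n)^('n + 'n) \<Rightarrow> bool" where
  "two_block_adhere A Z W \<longleftrightarrow>
    transpose Z = Z \<and> transpose W = W \<and>
    (\<exists>B. Z = 2 *\<^sub>R block_matrix (mat 1) (- transpose B) (- B) (mat 1) \<and>
      (\<forall>i j. i \<noteq> j \<and> A $ i $ j = 0 \<longrightarrow>
        B $ i $ j = 0 \<and> B $ j $ i = 0 \<and>
        W $ Inl i $ Inl j = 0 \<and> W $ Inr j $ Inl i = 0 \<and>
        W $ Inr i $ Inl j = 0 \<and> W $ Inr i $ Inr j = 0))"

end

theory Submission
  imports Defs
begin

text \<open>
  Let \<open>C\<close> have the same positive entries as some doubly stochastic matrix \<open>T\<close>. For every doubly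
  stochastic \<open>P\<close> supported in \<open>C\<close>, a scaling step lowers the cross entropy of \<open>P\<close> relative to the
  iterate by an amount that does not depend on \<open>P\<close>, and is nonnegative after the first step.
  With \<open>P = T\<close> the decreases are summable, so row and column sums tend to 1 and the positive entries
  stay away from 0; hence some subsequence converges to a doubly stochastic \<open>S\<close> with the support of
  \<open>C\<close>. With \<open>P = S\<close> the relative entropy of \<open>S\<close> with respect to the iterates tends to 0, so the
  whole sequence converges to \<open>S\<close>.

  For symmetric \<open>S\<close>, the quadratic form of \<open>W\<close> at \<open>(u, v)\<close> is
  \<open>2 \<Sum>\<^sub>i\<^sub>j S\<^sub>i\<^sub>j (u\<^sub>i - v\<^sub>j)\<^sup>2\<close>. It vanishes only if
  \<open>u\<^sub>i = v\<^sub>j\<close> along all edges and on the diagonal, so \<open>u = v\<close> is constant by connectedness.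
\<close>

section \<open>Doubly stochastic matrices and entropy inequalities\<close>

definition doubly_stochastic :: "real^'n::finite^'n \<Rightarrow> bool" where
  "doubly_stochastic S \<longleftrightarrow>
    (\<forall>i j. 0 \<le> S $ i $ j) \<and> (\<forall>i. (\<Sum>j\<in>UNIV. S $ i $ j) = 1) \<and> (\<forall>j. (\<Sum>i\<in>UNIV. S $ i $ j) = 1)"

lemma doubly_stochasticD:
  assumes "doubly_stochastic S"
  shows "0 \<le> S $ i $ j" "(\<Sum>j\<in>UNIV. S $ i $ j) = 1" "(\<Sum>i\<in>UNIV. S $ i $ j) = 1"
  using assms by (auto simp: doubly_stochastic_def)

lemma doubly_stochastic_transpose: "doubly_stochastic S \<Longrightarrow> doubly_stochastic (transpose S)"
  by (auto simp: doubly_stochastic_def transpose_def)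

text \<open>This is \<open>ln t \<le> t - 1\<close> at \<open>t = sqrt m / sqrt s\<close>; the
  square root turns the linear bound into a squared distance. The correction \<open>s - m\<close>
  cancels once summed over families of equal mass.\<close>

lemma hellinger_le_relative_entropy:
  fixes s m :: real
  assumes "0 \<le> s" "0 \<le> m" "0 < s \<Longrightarrow> 0 < m"
  shows "(sqrt s - sqrt m)\<^sup>2 + s - m \<le> s * ln s - s * ln m"
proof (cases "s = 0")
  case False
  then have s: "0 < s" and m: "0 < m" using assms by auto
  define t where "t = sqrt m / sqrt s"
  have t: "0 < t" and sqrt_m: "sqrt m = t * sqrt s" using s m by (simp_all add: t_def)
  have "ln m = 2 * ln t + ln s"
    using s m by (simp add: t_def ln_div ln_sqrt)
  moreover have "ln t \<le> t - 1"
    using t by (rule ln_le_minus_one)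
  ultimately have "s * (ln m - ln s) \<le> s * (2 * (t - 1))"
    using s by (intro mult_left_mono) auto
  also have "\<dots> = 2 * (sqrt s * sqrt m) - 2 * s"
    using s by (simp add: sqrt_m algebra_simps)
  finally show ?thesis
    using s m by (simp add: power2_eq_square algebra_simps)
qed (use assms in simp)

text \<open>Since \<open>ln 0 = 0\<close>, an entry with \<open>S > 0\<close> and
  \<open>X = 0\<close> counts as 0 instead of infinity. Support hypotheses in the lemmas below
  exclude this case.\<close>

definition cross_entropy :: "real^'n::finite^'n \<Rightarrow> real^'n^'n \<Rightarrow> real" where
  "cross_entropy S X = (\<Sum>i\<in>UNIV. \<Sum>j\<in>UNIV. S $ i $ j * - ln (X $ i $ j))"

lemma hellinger_le_cross_entropy:
  fixes S X :: "real^'n::finite^'n"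
  assumes "\<And>i j. 0 \<le> S $ i $ j" "\<And>i j. 0 \<le> X $ i $ j"
    and "\<And>i j. 0 < S $ i $ j \<Longrightarrow> 0 < X $ i $ j"
    and sum: "(\<Sum>i\<in>UNIV. \<Sum>j\<in>UNIV. X $ i $ j) = (\<Sum>i\<in>UNIV. \<Sum>j\<in>UNIV. S $ i $ j)"
  shows "(\<Sum>i\<in>UNIV. \<Sum>j\<in>UNIV. (sqrt (S $ i $ j) - sqrt (X $ i $ j))\<^sup>2)
    \<le> cross_entropy S X - cross_entropy S S"
proof -
  have "(\<Sum>i\<in>UNIV. \<Sum>j\<in>UNIV. (sqrt (S $ i $ j) - sqrt (X $ i $ j))\<^sup>2 + S $ i $ j - X $ i $ j)
    \<le> (\<Sum>i\<in>UNIV. \<Sum>j\<in>UNIV. S $ i $ j * ln (S $ i $ j) - S $ i $ j * ln (X $ i $ j))"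
    by (intro sum_mono hellinger_le_relative_entropy assms)
  then show ?thesis
    using sum by (simp add: cross_entropy_def sum.distrib sum_subtractf sum_negf)
qed

lemma entry_hellinger_le:
  fixes S X :: "real^'n::finite^'n"
  shows "(sqrt (S $ i $ j) - sqrt (X $ i $ j))\<^sup>2
    \<le> (\<Sum>i\<in>UNIV. \<Sum>j\<in>UNIV. (sqrt (S $ i $ j) - sqrt (X $ i $ j))\<^sup>2)"
proof -
  have "(sqrt (S $ i $ j) - sqrt (X $ i $ j))\<^sup>2
      \<le> (\<Sum>j\<in>UNIV. (sqrt (S $ i $ j) - sqrt (X $ i $ j))\<^sup>2)"
    by (rule member_le_sum) auto
  also have "\<dots> \<le> (\<Sum>i\<in>UNIV. \<Sum>j\<in>UNIV. (sqrt (S $ i $ j) - sqrt (X $ i $ j))\<^sup>2)"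
    by (rule member_le_sum) (auto intro!: sum_nonneg)
  finally show ?thesis .
qed

text \<open>The square roots converge by squeezing, and squaring them recovers \<open>f\<close> and
  \<open>s\<close> by nonnegativity.\<close>

lemma tendsto_if_hellinger_le:
  fixes f :: "nat \<Rightarrow> real"
  assumes "0 \<le> s" and "\<And>k. 0 \<le> f k"
    and le: "\<forall>\<^sub>F k in sequentially. (sqrt s - sqrt (f k))\<^sup>2 \<le> e k" and "e \<longlonglongrightarrow> 0"
  shows "f \<longlonglongrightarrow> s"
proof -
  have "(\<lambda>k. (sqrt s - sqrt (f k))\<^sup>2) \<longlonglongrightarrow> 0"
    by (rule tendsto_sandwich[OF _ le tendsto_const \<open>e \<longlonglongrightarrow> 0\<close>]) simp
  then have "(\<lambda>k. sqrt ((sqrt s - sqrt (f k))\<^sup>2)) \<longlonglongrightarrow> sqrt 0"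
    by (rule tendsto_real_sqrt)
  then have "(\<lambda>k. sqrt s - sqrt (f k)) \<longlonglongrightarrow> 0"
    by (simp add: tendsto_rabs_zero_iff)
  then have "(\<lambda>k. (sqrt s - (sqrt s - sqrt (f k)))\<^sup>2) \<longlonglongrightarrow> (sqrt s - 0)\<^sup>2"
    by (intro tendsto_intros)
  then show ?thesis using assms(1,2) by simp
qed

text \<open>Where \<open>P\<close> is positive the limit entry is positive, so \<open>ln\<close> is
  continuous there; all other terms are constantly 0.\<close>

lemma tendsto_cross_entropy:
  fixes X :: "nat \<Rightarrow> real^'n::finite^'n"
  assumes X: "X \<longlonglongrightarrow> S" and pos: "\<And>i j. 0 < P $ i $ j \<Longrightarrow> 0 < S $ i $ j"
    and nonneg: "\<And>i j. 0 \<le> P $ i $ j"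
  shows "(\<lambda>k. cross_entropy P (X k)) \<longlonglongrightarrow> cross_entropy P S"
  unfolding cross_entropy_def
proof (intro tendsto_sum)
  fix i j
  show "(\<lambda>k. P $ i $ j * - ln (X k $ i $ j)) \<longlonglongrightarrow> P $ i $ j * - ln (S $ i $ j)"
    using nonneg[of i j] pos[of i j] X
    by (cases "P $ i $ j = 0") (auto intro!: tendsto_intros)
qed

section \<open>Sinkhorn-Knopp scaling on a doubly stochastic pattern\<close>

text \<open>Sharing the exact pattern of a doubly stochastic matrix is stronger than having support:
  every positive entry then lies on a positive permutation, and none dies out in the limit.\<close>

locale doubly_stochastic_pattern =
  fixes C T :: "real^'n::finite^'n"
  assumes T_doubly_stochastic: "doubly_stochastic T"
    and C_nonneg: "0 \<le> C $ i $ j"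
    and pattern: "0 < T $ i $ j \<longleftrightarrow> 0 < C $ i $ j"
begin

abbreviation M :: "nat \<Rightarrow> real^'n^'n" where
  "M \<equiv> sinkhorn_knopp_seq C"

text \<open>The divisors of step \<open>k\<close>, with the parity convention of
  \<open>sinkhorn_knopp_seq\<close>. One name for both cases lets row and column steps share most
  proofs.\<close>

definition scaled_sum :: "nat \<Rightarrow> 'n \<Rightarrow> real" where
  "scaled_sum k i =
    (if even k then \<Sum>j\<in>UNIV. M k $ i $ j else \<Sum>j\<in>UNIV. M k $ j $ i)"

lemma M_Suc:
  "M (Suc k) $ i $ j = M k $ i $ j / scaled_sum k (if even k then i else j)"
  by (simp add: scaled_sum_def scale_rows_def scale_cols_def)

lemma row_nonzero: "\<exists>j. 0 < C $ i $ j"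
  and col_nonzero: "\<exists>i. 0 < C $ i $ j"
proof -
  have "\<exists>j. 0 < T $ i $ j"
  proof (rule ccontr)
    assume "\<nexists>j. 0 < T $ i $ j"
    then have "(\<Sum>j\<in>UNIV. T $ i $ j) \<le> 0" by (intro sum_nonpos) (auto simp: not_less)
    with doubly_stochasticD(2)[OF T_doubly_stochastic, of i] show False by simp
  qed
  moreover have "\<exists>i. 0 < T $ i $ j"
  proof (rule ccontr)
    assume "\<nexists>i. 0 < T $ i $ j"
    then have "(\<Sum>i\<in>UNIV. T $ i $ j) \<le> 0" by (intro sum_nonpos) (auto simp: not_less)
    with doubly_stochasticD(3)[OF T_doubly_stochastic, of j] show False by simp
  qed
  ultimately show "\<exists>j. 0 < C $ i $ j" "\<exists>i. 0 < C $ i $ j" by (auto simp: pattern)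
qed

lemma M_nonneg_pattern:
  "(\<forall>i j. 0 \<le> M k $ i $ j \<and> (0 < M k $ i $ j \<longleftrightarrow> 0 < C $ i $ j)) \<and> (\<forall>i. 0 < scaled_sum k i)"
proof (induction k)
  \<comment> \<open>Stated for every \<open>k\<close>, so that it serves both the base case and the
    induction step: each row and column of \<open>C\<close> has a positive entry, which the pattern
    carries over to \<open>M k\<close>.\<close>
  have pos: "0 < scaled_sum k i"
    if M: "\<forall>i j. 0 \<le> M k $ i $ j \<and> (0 < M k $ i $ j \<longleftrightarrow> 0 < C $ i $ j)" for k i
  proof -
    obtain a b where "0 < M k $ i $ a" and "0 < M k $ b $ i"
      using row_nonzero[of i] col_nonzero[of i] M by blast
    then show ?thesis
      using M sum_pos2[of UNIV a "\<lambda>j. M k $ i $ j"] sum_pos2[of UNIV b "\<lambda>j. M k $ j $ i"]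
      by (simp add: scaled_sum_def)
  qed
  {
    case 0
    show ?case using pos[of 0] C_nonneg by simp
  next
    case (Suc k)
    then have "\<forall>i j. 0 \<le> M (Suc k) $ i $ j \<and> (0 < M (Suc k) $ i $ j \<longleftrightarrow> 0 < C $ i $ j)"
      unfolding M_Suc by (metis divide_nonneg_pos zero_less_divide_iff order_less_imp_not_less)
    then show ?case using pos by blast
  }
qed

lemma M_nonneg: "0 \<le> M k $ i $ j"
  and M_pos_iff: "0 < M k $ i $ j \<longleftrightarrow> 0 < C $ i $ j"
  and scaled_sum_pos: "0 < scaled_sum k i"
  using M_nonneg_pattern by blast+

lemma row_sum_odd: "odd k \<Longrightarrow> (\<Sum>j\<in>UNIV. M k $ i $ j) = 1"
  and col_sum_even: "even k \<Longrightarrow> 0 < k \<Longrightarrow> (\<Sum>i\<in>UNIV. M k $ i $ j) = 1"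
proof -
  assume "odd k"
  then obtain l where l: "k = Suc l" "even l" by (metis odd_Suc_minus_one even_Suc)
  then have "(\<Sum>j\<in>UNIV. M k $ i $ j) = scaled_sum l i / scaled_sum l i"
    unfolding l(1) M_Suc using l(2) by (simp flip: sum_divide_distrib add: scaled_sum_def)
  then show "(\<Sum>j\<in>UNIV. M k $ i $ j) = 1"
    using scaled_sum_pos[of l i] by simp
next
  assume "even k" "0 < k"
  then obtain l where l: "k = Suc l" "odd l" by (metis even_Suc not0_implies_Suc less_numeral_extra(3))
  then have "(\<Sum>i\<in>UNIV. M k $ i $ j) = scaled_sum l j / scaled_sum l j"
    unfolding l(1) M_Suc using l(2) by (simp flip: sum_divide_distrib add: scaled_sum_def)
  then show "(\<Sum>i\<in>UNIV. M k $ i $ j) = 1"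
    using scaled_sum_pos[of l j] by simp
qed

text \<open>From the first scaling on, the mass equals that of any doubly stochastic matrix, as
  \<open>hellinger_le_cross_entropy\<close> requires.\<close>

lemma sum_M: "0 < k \<Longrightarrow> (\<Sum>i\<in>UNIV. \<Sum>j\<in>UNIV. M k $ i $ j) = real CARD('n)"
  by (cases "even k") (simp_all add: row_sum_odd col_sum_even sum.swap[of "\<lambda>i j. M k $ i $ j"])

lemma M_le_one:
  assumes "0 < k"
  shows "M k $ i $ j \<le> 1"
proof (cases "even k")
  case True
  have "M k $ i $ j \<le> (\<Sum>i\<in>UNIV. M k $ i $ j)" by (rule member_le_sum) (auto simp: M_nonneg)
  with True assms show ?thesis by (simp add: col_sum_even)
next
  case False
  have "M k $ i $ j \<le> (\<Sum>j\<in>UNIV. M k $ i $ j)" by (rule member_le_sum) (auto simp: M_nonneg)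
  with False show ?thesis by (simp add: row_sum_odd)
qed

text \<open>The negative logarithm of the product of all divisors in step \<open>k\<close>; the sign
  makes it the drop in cross entropy.\<close>

definition gain :: "nat \<Rightarrow> real" where
  "gain k = - (\<Sum>i\<in>UNIV. ln (scaled_sum k i))"

text \<open>Dividing an entry by its divisor \<open>r\<close> adds \<open>S $ i $ j * ln r\<close>.
  A row step has \<open>r\<close> depending only on \<open>i\<close>, a column step only on
  \<open>j\<close>; summing over the other index uses a unit row or column sum of \<open>S\<close>,
  so \<open>S\<close> drops out.\<close>

lemma cross_entropy_Suc:
  assumes S: "doubly_stochastic S" and supp: "\<And>i j. 0 < S $ i $ j \<Longrightarrow> 0 < C $ i $ j"
  shows "cross_entropy S (M (Suc k)) = cross_entropy S (M k) - gain k"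
proof -
  let ?r = "\<lambda>i j. ln (scaled_sum k (if even k then i else j))"
  have "S $ i $ j * - ln (M (Suc k) $ i $ j) = S $ i $ j * - ln (M k $ i $ j) + S $ i $ j * ?r i j"
    for i j
  proof (cases "S $ i $ j = 0")
    case False
    with doubly_stochasticD(1)[OF S, of i j] supp have "0 < M k $ i $ j"
      by (simp add: M_pos_iff)
    then show ?thesis
      unfolding M_Suc using scaled_sum_pos[of k "if even k then i else j"]
      by (simp add: ln_div right_diff_distrib del: if_split)
  qed simp
  then have "cross_entropy S (M (Suc k)) =
      cross_entropy S (M k) + (\<Sum>i\<in>UNIV. \<Sum>j\<in>UNIV. S $ i $ j * ?r i j)"
    by (simp only: cross_entropy_def sum.distrib)
  also have "(\<Sum>i\<in>UNIV. \<Sum>j\<in>UNIV. S $ i $ j * ?r i j) = - gain k"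
  proof (cases "even k")
    case True
    then show ?thesis
      by (simp add: gain_def doubly_stochasticD[OF S] flip: sum_distrib_right)
  next
    case False
    then have "(\<Sum>i\<in>UNIV. \<Sum>j\<in>UNIV. S $ i $ j * ?r i j) =
        (\<Sum>j\<in>UNIV. \<Sum>i\<in>UNIV. S $ i $ j * ln (scaled_sum k j))"
      by (simp add: sum.swap[of "\<lambda>i j. S $ i $ j * ln (scaled_sum k j)"])
    then show ?thesis
      by (simp add: gain_def doubly_stochasticD[OF S] flip: sum_distrib_right)
  qed
  finally show ?thesis by simp
qed

lemma cross_entropy_M:
  assumes "doubly_stochastic S" "\<And>i j. 0 < S $ i $ j \<Longrightarrow> 0 < C $ i $ j"
  shows "cross_entropy S (M k) = cross_entropy S C - (\<Sum>l<k. gain l)"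
  by (induction k) (simp_all add: cross_entropy_Suc[OF assms] del: sinkhorn_knopp_seq.simps(2))

text \<open>The entropy inequality with \<open>s = 1\<close>, applied to each divisor. The divisors
  add up to n after the first step, so the linear terms cancel.\<close>

lemma gain_ge:
  assumes "0 < k"
  shows "(\<Sum>i\<in>UNIV. (1 - sqrt (scaled_sum k i))\<^sup>2) \<le> gain k"
proof -
  have "(\<Sum>i\<in>UNIV. (sqrt 1 - sqrt (scaled_sum k i))\<^sup>2 + 1 - scaled_sum k i)
      \<le> (\<Sum>i\<in>UNIV. 1 * ln 1 - 1 * ln (scaled_sum k i))"
    by (intro sum_mono hellinger_le_relative_entropy) (auto simp: scaled_sum_pos less_imp_le)
  moreover have "(\<Sum>i\<in>UNIV. scaled_sum k i) = real CARD('n)"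
    using sum_M[OF assms] sum.swap[of "\<lambda>i j. M k $ i $ j" UNIV UNIV]
    by (cases "even k") (simp_all add: scaled_sum_def)
  ultimately show ?thesis
    by (simp add: gain_def sum.distrib sum_subtractf sum_negf)
qed

lemma gain_nonneg: "0 < k \<Longrightarrow> 0 \<le> gain k"
  by (rule order_trans[OF _ gain_ge]) (auto intro: sum_nonneg)

lemma cross_entropy_M_nonneg:
  assumes "doubly_stochastic S" "0 < k"
  shows "0 \<le> cross_entropy S (M k)"
  unfolding cross_entropy_def
proof (intro sum_nonneg mult_nonneg_nonneg)
  fix i j
  \<comment> \<open>Nonzero entries lie in (0, 1]; a zero entry is harmless because
    \<open>ln 0 = 0\<close>.\<close>
  show "0 \<le> - ln (M k $ i $ j)"
    using M_le_one[OF \<open>0 < k\<close>, of i j] M_nonneg[of k i j]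
    by (cases "M k $ i $ j = 0") auto
qed (use assms in \<open>auto simp: doubly_stochasticD\<close>)

text \<open>The gains telescope against a cross entropy that stays nonnegative. The sum is shifted
  by one because \<open>gain 0\<close>, which depends on the unnormalized \<open>C\<close>, may be
  negative.\<close>

lemma summable_gain: "summable gain"
proof -
  have "(\<Sum>l<k. gain (Suc l)) \<le> cross_entropy T C - gain 0" for k
    using cross_entropy_M_nonneg[OF T_doubly_stochastic, of "Suc k"]
      cross_entropy_M[OF T_doubly_stochastic, of "Suc k"] pattern
    by (simp add: sum.lessThan_Suc_shift del: sinkhorn_knopp_seq.simps(2) sum.lessThan_Suc)
  then have "summable (\<lambda>l. gain (Suc l))"
    by (intro bounded_imp_summable[where B = "cross_entropy T C - gain 0"])
      (auto simp: gain_nonneg simp del: sum.lessThan_Suc simp flip: lessThan_Suc_atMost)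
  then show ?thesis by (simp add: summable_Suc_iff)
qed

lemma scaled_sum_tendsto: "(\<lambda>k. scaled_sum k i) \<longlonglongrightarrow> 1"
proof (rule tendsto_if_hellinger_le[OF _ _ _ summable_LIMSEQ_zero[OF summable_gain]])
  have "(sqrt 1 - sqrt (scaled_sum k i))\<^sup>2 \<le> gain k" if "0 < k" for k
    using gain_ge[OF that]
      member_le_sum[of i UNIV "\<lambda>i. (sqrt 1 - sqrt (scaled_sum k i))\<^sup>2"]
    by simp
  then show "\<forall>\<^sub>F k in sequentially. (sqrt 1 - sqrt (scaled_sum k i))\<^sup>2 \<le> gain k"
    by (rule eventually_mono[OF eventually_gt_at_top[of 0]])
qed (auto simp: scaled_sum_pos less_imp_le)

lemma row_sum_tendsto: "(\<lambda>k. \<Sum>j\<in>UNIV. M k $ i $ j) \<longlonglongrightarrow> 1"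
proof (rule LIM_zero_cancel, rule Lim_null_comparison)
  show "(\<lambda>k. norm (scaled_sum k i - 1)) \<longlonglongrightarrow> 0"
    by (intro tendsto_norm_zero LIM_zero scaled_sum_tendsto)
  show "\<forall>\<^sub>F k in sequentially. norm ((\<Sum>j\<in>UNIV. M k $ i $ j) - 1) \<le> norm (scaled_sum k i - 1)"
    \<comment> \<open>For even \<open>k\<close> the row sum is the divisor itself, for odd
      \<open>k\<close> it is exactly 1.\<close>
    by (intro always_eventually) (auto simp: scaled_sum_def row_sum_odd)
qed

lemma col_sum_tendsto: "(\<lambda>k. \<Sum>i\<in>UNIV. M k $ i $ j) \<longlonglongrightarrow> 1"
proof (rule LIM_zero_cancel, rule Lim_null_comparison)
  show "(\<lambda>k. norm (scaled_sum k j - 1)) \<longlonglongrightarrow> 0"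
    by (intro tendsto_norm_zero LIM_zero scaled_sum_tendsto)
  show "\<forall>\<^sub>F k in sequentially. norm ((\<Sum>i\<in>UNIV. M k $ i $ j) - 1) \<le> norm (scaled_sum k j - 1)"
    \<comment> \<open>Index 0 is even but \<open>C\<close> has not been column-scaled, so it must be
      skipped here.\<close>
    using eventually_gt_at_top[of 0]
    by (rule eventually_mono) (auto simp: scaled_sum_def col_sum_even)
qed

text \<open>The cross entropy of \<open>T\<close> is bounded above and all its terms are
  nonnegative, so no single term \<open>T $ i $ j * - ln (M k $ i $ j)\<close> can exceed that
  bound; solving for the entry gives the exponential.\<close>

lemma M_bounded_below:
  assumes "0 < C $ i $ j"
  obtains \<delta> where "0 < \<delta>" "\<And>k. 0 < k \<Longrightarrow> \<delta> \<le> M k $ i $ j"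
proof -
  let ?c = "cross_entropy T C - gain 0"
  have T: "0 < T $ i $ j" using assms pattern by simp
  have "exp (- ?c / T $ i $ j) \<le> M k $ i $ j" if k: "0 < k" for k
  proof -
    have nonneg: "0 \<le> T $ i $ j * - ln (M k $ i $ j)" for i j
      using M_le_one[OF k, of i j] M_nonneg[of k i j] doubly_stochasticD(1)[OF T_doubly_stochastic]
      by (intro mult_nonneg_nonneg) (cases "M k $ i $ j = 0"; auto)+
    have "T $ i $ j * - ln (M k $ i $ j) \<le> (\<Sum>j\<in>UNIV. T $ i $ j * - ln (M k $ i $ j))"
      using nonneg by (intro member_le_sum) auto
    also have "\<dots> \<le> cross_entropy T (M k)"
      unfolding cross_entropy_def using nonneg by (intro member_le_sum sum_nonneg) auto
    \<comment> \<open>Split off \<open>gain 0\<close>; the later gains are nonnegative and only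
      lower the cross entropy.\<close>
    also have "\<dots> \<le> ?c"
    proof -
      obtain l where "k = Suc l" using k not0_implies_Suc by blast
      then show ?thesis
        using cross_entropy_M[OF T_doubly_stochastic, of k] pattern
        by (simp add: sum.lessThan_Suc_shift gain_nonneg sum_nonneg
            del: sinkhorn_knopp_seq.simps(2) sum.lessThan_Suc)
    qed
    finally have "- ?c / T $ i $ j \<le> ln (M k $ i $ j)"
      using T by (simp add: field_simps)
    then show ?thesis
      using M_pos_iff[of k i j] assms by (simp add: ln_ge_iff)
  qed
  then show ?thesis by (intro that[of "exp (- ?c / T $ i $ j)"]) auto
qed

lemma M_zero: "\<not> 0 < C $ i $ j \<Longrightarrow> M k $ i $ j = 0"
  using M_pos_iff[of k i j] M_nonneg[of k i j] by simp

section \<open>Convergence of the scaling sequence and symmetry of its limit\<close>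

text \<open>The last conclusion records that the total drop is the same for all \<open>P\<close>; it
  is what later forces the limit of a symmetric matrix to be symmetric.\<close>

theorem sinkhorn_knopp_limit:
  obtains S where "M \<longlonglongrightarrow> S" "doubly_stochastic S"
    "\<And>i j. 0 < S $ i $ j \<longleftrightarrow> 0 < C $ i $ j"
    "\<And>P. doubly_stochastic P \<Longrightarrow> (\<And>i j. 0 < P $ i $ j \<Longrightarrow> 0 < C $ i $ j) \<Longrightarrow>
      cross_entropy P S = cross_entropy P C - suminf gain"
proof -
  have "norm (M (Suc k)) \<le> (\<Sum>i\<in>(UNIV::'n set). \<Sum>j\<in>(UNIV::'n set). 1)" for k
  proof -
    have "norm (M (Suc k)) \<le> (\<Sum>i\<in>UNIV. \<Sum>j\<in>UNIV. norm (M (Suc k) $ i $ j))"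
      unfolding norm_vec_def
      by (intro order_trans[OF L2_set_le_sum sum_mono] L2_set_le_sum) auto
    also have "\<dots> \<le> (\<Sum>i\<in>(UNIV::'n set). \<Sum>j\<in>(UNIV::'n set). 1)"
      using M_nonneg M_le_one[of "Suc k"]
      by (intro sum_mono) (simp del: sinkhorn_knopp_seq.simps)
    finally show ?thesis .
  qed
  then have "bounded (range (\<lambda>k. M (Suc k)))"
    by (intro boundedI) auto
  then obtain S r where r: "strict_mono r" and lim: "((\<lambda>k. M (Suc k)) \<circ> r) \<longlonglongrightarrow> S"
    using bounded_imp_convergent_subsequence by blast
  \<comment> \<open>Indices of the subsequence in \<open>M\<close> itself; they are positive, so the
    bounds valid after the first scaling apply.\<close>
  define q where "q = Suc \<circ> r"
  have q: "strict_mono q" and "\<And>k. 0 < q k"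
    using r by (auto simp: q_def strict_mono_def)
  have Mq: "(\<lambda>k. M (q k)) \<longlonglongrightarrow> S"
    using lim by (simp add: q_def o_def)
  then have entry: "(\<lambda>k. M (q k) $ i $ j) \<longlonglongrightarrow> S $ i $ j" for i j
    by (intro tendsto_intros)
  have S_nonneg: "0 \<le> S $ i $ j" for i j
    by (rule LIMSEQ_le_const[OF entry]) (auto simp: M_nonneg)
  have S_pattern: "0 < S $ i $ j \<longleftrightarrow> 0 < C $ i $ j" for i j
  proof (cases "0 < C $ i $ j")
    case True
    then obtain \<delta> where "0 < \<delta>" "\<And>k. 0 < k \<Longrightarrow> \<delta> \<le> M k $ i $ j"
      using M_bounded_below by blast
    moreover from this have "\<delta> \<le> S $ i $ j"
      by (intro LIMSEQ_le_const[OF entry]) (auto simp: \<open>\<And>k. 0 < q k\<close>)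
    ultimately show ?thesis using True by simp
  next
    case False
    then have "S $ i $ j = 0"
      using LIMSEQ_unique[OF entry[of i j]] by (simp add: M_zero)
    with False show ?thesis by simp
  qed
  have S: "doubly_stochastic S"
    unfolding doubly_stochastic_def
  proof (intro conjI allI)
    fix i
    have "(\<lambda>k. \<Sum>j\<in>UNIV. M (q k) $ i $ j) \<longlonglongrightarrow> (\<Sum>j\<in>UNIV. S $ i $ j)"
      by (intro tendsto_sum entry)
    moreover have "(\<lambda>k. \<Sum>j\<in>UNIV. M (q k) $ i $ j) \<longlonglongrightarrow> 1"
      using LIMSEQ_subseq_LIMSEQ[OF row_sum_tendsto q] by (simp add: o_def)
    ultimately show "(\<Sum>j\<in>UNIV. S $ i $ j) = 1" by (rule LIMSEQ_unique)
  next
    fix j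
    have "(\<lambda>k. \<Sum>i\<in>UNIV. M (q k) $ i $ j) \<longlonglongrightarrow> (\<Sum>i\<in>UNIV. S $ i $ j)"
      by (intro tendsto_sum entry)
    moreover have "(\<lambda>k. \<Sum>i\<in>UNIV. M (q k) $ i $ j) \<longlonglongrightarrow> 1"
      using LIMSEQ_subseq_LIMSEQ[OF col_sum_tendsto q] by (simp add: o_def)
    ultimately show "(\<Sum>i\<in>UNIV. S $ i $ j) = 1" by (rule LIMSEQ_unique)
  qed (rule S_nonneg)
  \<comment> \<open>This limit is along the whole sequence; the next fact identifies its value
    through the subsequence.\<close>
  have ce_M: "(\<lambda>k. cross_entropy P (M k)) \<longlonglongrightarrow> cross_entropy P C - suminf gain"
    if "doubly_stochastic P" "\<And>i j. 0 < P $ i $ j \<Longrightarrow> 0 < C $ i $ j" for P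
  proof -
    have "(\<lambda>k. cross_entropy P C - (\<Sum>l<k. gain l)) \<longlonglongrightarrow> cross_entropy P C - suminf gain"
      by (intro tendsto_intros summable_LIMSEQ summable_gain)
    then show ?thesis using that by (simp add: cross_entropy_M)
  qed
  have ce_S: "cross_entropy P S = cross_entropy P C - suminf gain"
    if P: "doubly_stochastic P" "\<And>i j. 0 < P $ i $ j \<Longrightarrow> 0 < C $ i $ j" for P
  proof (rule LIMSEQ_unique)
    show "(\<lambda>k. cross_entropy P (M (q k))) \<longlonglongrightarrow> cross_entropy P S"
      using P S_pattern by (intro tendsto_cross_entropy Mq) (auto simp: doubly_stochasticD)
    show "(\<lambda>k. cross_entropy P (M (q k))) \<longlonglongrightarrow> cross_entropy P C - suminf gain"
      using LIMSEQ_subseq_LIMSEQ[OF ce_M[OF P] q] by (simp add: o_def)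
  qed
  \<comment> \<open>Taking \<open>P = S\<close> upgrades subsequential convergence: the gap
    dominates every squared difference of square roots of entries.\<close>
  have gap: "(\<lambda>k. cross_entropy S (M k) - cross_entropy S S) \<longlonglongrightarrow> 0"
    using tendsto_diff[OF ce_M[OF S] tendsto_const[of "cross_entropy S S"]] S_pattern ce_S[OF S]
    by simp
  have "(\<lambda>k. M k $ i $ j) \<longlonglongrightarrow> S $ i $ j" for i j
  proof (rule tendsto_if_hellinger_le[OF S_nonneg M_nonneg _ gap])
    have "(sqrt (S $ i $ j) - sqrt (M k $ i $ j))\<^sup>2 \<le> cross_entropy S (M k) - cross_entropy S S"
      if "0 < k" for k
      using that S
      by (intro order_trans[OF entry_hellinger_le hellinger_le_cross_entropy])
        (auto simp: S_nonneg M_nonneg M_pos_iff S_pattern sum_M doubly_stochasticD)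
    then show "\<forall>\<^sub>F k in sequentially.
        (sqrt (S $ i $ j) - sqrt (M k $ i $ j))\<^sup>2 \<le> cross_entropy S (M k) - cross_entropy S S"
      by (rule eventually_mono[OF eventually_gt_at_top[of 0]])
  qed
  then have "M \<longlonglongrightarrow> S"
    by (intro vec_tendstoI)
  with S S_pattern ce_S that show ?thesis by blast
qed

text \<open>
  The cross entropy relative to the limit \<open>S\<close> is determined by that relative to \<open>C\<close>, and a symmetric
  \<open>C\<close> does not tell \<open>S\<close> from its transpose, so their relative entropy is 0.
\<close>

lemma sinkhorn_knopp_symmetric_limit:
  assumes C: "transpose C = C"
  obtains S where "M \<longlonglongrightarrow> S" "doubly_stochastic S" "transpose S = S"
    "\<And>i j. 0 < S $ i $ j \<longleftrightarrow> 0 < C $ i $ j"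
proof -
  obtain S where S: "M \<longlonglongrightarrow> S" "doubly_stochastic S"
    "\<And>i j. 0 < S $ i $ j \<longleftrightarrow> 0 < C $ i $ j"
    and ce: "\<And>P. doubly_stochastic P \<Longrightarrow> (\<And>i j. 0 < P $ i $ j \<Longrightarrow> 0 < C $ i $ j) \<Longrightarrow>
      cross_entropy P S = cross_entropy P C - suminf gain"
    using sinkhorn_knopp_limit by blast
  let ?P = "transpose S"
  have P: "doubly_stochastic ?P" by (simp add: doubly_stochastic_transpose S(2))
  have sym: "C $ i $ j = C $ j $ i" for i j
    using C by (metis transpose_def vec_lambda_beta)
  have pos: "0 < ?P $ i $ j \<longleftrightarrow> 0 < C $ i $ j" for i j
    using S(3)[of j i] sym by (simp add: transpose_def)
  \<comment> \<open>Transposing both arguments merely reorders the double sum.\<close>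
  have "cross_entropy ?P ?P = cross_entropy S S"
    unfolding cross_entropy_def transpose_def by (subst sum.swap) simp
  moreover have "cross_entropy ?P C = cross_entropy S C"
    unfolding cross_entropy_def transpose_def
    by (subst sum.swap) (simp add: sym)
  ultimately have "cross_entropy ?P S - cross_entropy ?P ?P = 0"
    using ce[OF P] ce[OF S(2)] pos S(3) by simp
  then have "(sqrt (?P $ i $ j) - sqrt (S $ i $ j))\<^sup>2 \<le> 0" for i j
    using P S(2)
    by (metis (no_types, lifting) order_trans[OF entry_hellinger_le hellinger_le_cross_entropy]
        doubly_stochasticD(1,2) pos S(3) sum.cong)
  then have "?P = S" by (simp add: vec_eq_iff)
  with S that show ?thesis by blast
qed

end

section \<open>Graph input: doubly stochastic pattern, support, connectivity\<close>

lemma symmetric_pattern_doubly_stochastic: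
  fixes A :: "real^'n::finite^'n"
  assumes A: "\<And>i j. A $ i $ j \<in> {0, 1}" and sym: "\<And>i j. A $ i $ j = A $ j $ i"
  obtains T where "doubly_stochastic_pattern (A + mat 1) T"
proof -
  \<comment> \<open>Degrees are at most n, so this denominator leaves a strictly positive holding
    probability \<open>1 - d i / N\<close> at every node.\<close>
  define N where "N = real CARD('n) + 1"
  define d where "d i = (\<Sum>k\<in>UNIV. A $ i $ k)" for i
  have A0: "0 \<le> A $ i $ j" and A1: "A $ i $ j \<le> 1" for i j
    using A[of i j] by auto
  have d: "0 \<le> d i" "d i < N" for i
  proof -
    show "0 \<le> d i" unfolding d_def by (rule sum_nonneg) (rule A0)
    have "d i \<le> (\<Sum>k\<in>(UNIV::'n set). 1)"
      unfolding d_def by (rule sum_mono) (rule A1)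
    then show "d i < N" by (simp add: N_def)
  qed
  have N: "0 < N" by (simp add: N_def)
  \<comment> \<open>one step of a lazy random walk on the graph\<close>
  define T :: "real^'n^'n" where
    "T = (\<chi> i j. (if i = j then 1 - d i / N else 0) + A $ i $ j / N)"
  have diag: "0 < 1 - d i / N" for i using d N by simp
  have nonneg: "0 \<le> T $ i $ j" for i j
    using diag[of i] A0[of i j] N by (auto simp: T_def intro!: add_nonneg_nonneg divide_nonneg_pos)
  have rows: "(\<Sum>j\<in>UNIV. T $ i $ j) = 1" for i
    by (simp add: T_def sum.distrib d_def flip: sum_divide_distrib)
  have T_sym: "T $ i $ j = T $ j $ i" for i j by (simp add: T_def sym)
  have "doubly_stochastic T"
    unfolding doubly_stochastic_def using nonneg rows T_sym by (metis (no_types, lifting) sum.cong)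
  moreover have "0 < T $ i $ j \<longleftrightarrow> 0 < (A + mat 1) $ i $ j" for i j
    using add_pos_nonneg[OF diag[of i], of "A $ i $ j / N"] A0[of i j] N
    by (cases "i = j") (simp_all add: T_def mat_def zero_less_divide_iff add_nonneg_pos)
  ultimately have "doubly_stochastic_pattern (A + mat 1) T"
    using A0 by unfold_locales (auto simp: mat_def)
  then show ?thesis by (rule that)
qed

lemma has_support_if_diagonal_pos: "(\<And>i. 0 < C $ i $ i) \<Longrightarrow> has_support C"
  unfolding has_support_def by (intro exI[of _ Id]) auto

text \<open>Induction along a path. Connectedness refers to the symmetric closure, so an edge may be
  traversed in either direction and \<open>step\<close> is used both ways.\<close>

lemma connected_adjacency_matrix_const:
  assumes "connected_adjacency_matrix A"
    and step: "\<And>i j. A $ i $ j = 1 \<Longrightarrow> f i = f j"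
  shows "f u = f v"
proof -
  have "u \<rightarrow>\<^sup>*\<^bsub>mk_symmetric (adjacency_graph A)\<^esub> v"
    using assms(1)
    by (auto simp: connected_adjacency_matrix_def Digraph_Component.connected_def
        strongly_connected_def adjacency_graph_def)
  then have "(u, v) \<in> (arcs_ends (mk_symmetric (adjacency_graph A)))\<^sup>*"
    by (rule reachable_rtranclI)
  then show ?thesis
  proof induction
    case (step y z)
    then show ?case
      using assms(2)[of y z] assms(2)[of z y]
      by (auto simp: parcs_mk_symmetric adjacency_graph_def)
  qed simp
qed

section \<open>The block matrix: quadratic form and kernel\<close>

lemma sum_UNIV_Plus:
  fixes f :: "'a::finite + 'b::finite \<Rightarrow> 'c::comm_monoid_add"
  shows "sum f UNIV = (\<Sum>i\<in>UNIV. f (Inl i)) + (\<Sum>j\<in>UNIV. f (Inr j))"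
  by (simp flip: UNIV_Plus_UNIV add: sum.Plus)

text \<open>Unit row and column sums let each square \<open>(x $ Inl i)\<^sup>2\<close> and
  \<open>(x $ Inr j)\<^sup>2\<close> be spread over the edges with weights \<open>S $ i $ j\<close>;
  symmetry merges the two cross terms, completing the squares.\<close>

lemma bipartite_quadratic_form:
  fixes S :: "real^'n::finite^'n"
  assumes S: "doubly_stochastic S" and sym: "transpose S = S"
  shows "x \<bullet> (block_matrix (mat 1) (- S) (- S) (mat 1) *v x) =
    (\<Sum>i\<in>UNIV. \<Sum>j\<in>UNIV. S $ i $ j * (x $ Inl i - x $ Inr j)\<^sup>2)"
proof -
  let ?u = "\<lambda>i. x $ Inl i" and ?v = "\<lambda>i. x $ Inr i"
  have S_sym: "S $ i $ j = S $ j $ i" for i j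
    using sym by (metis transpose_def vec_lambda_beta)
  have "x \<bullet> (block_matrix (mat 1) (- S) (- S) (mat 1) *v x) =
    (\<Sum>i\<in>UNIV. ?u i * (?u i - (\<Sum>j\<in>UNIV. S $ i $ j * ?v j))) +
    (\<Sum>j\<in>UNIV. ?v j * (?v j - (\<Sum>i\<in>UNIV. S $ j $ i * ?u i)))"
    by (simp add: inner_vec_def matrix_vector_mult_def sum_UNIV_Plus block_matrix_def mat_def
        sum_negf if_distrib if_distribR cong: if_cong)
  also have "\<dots> = (\<Sum>i\<in>UNIV. (?u i)\<^sup>2) + (\<Sum>j\<in>UNIV. (?v j)\<^sup>2)
      - 2 * (\<Sum>i\<in>UNIV. \<Sum>j\<in>UNIV. S $ i $ j * ?u i * ?v j)"
    using sum.swap[of "\<lambda>i j. S $ i $ j * ?u i * ?v j" UNIV UNIV]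
    by (simp add: right_diff_distrib sum_subtractf sum_negf sum_distrib_left power2_eq_square S_sym mult_ac)
  also have "(\<Sum>i\<in>UNIV. (?u i)\<^sup>2) = (\<Sum>i\<in>UNIV. \<Sum>j\<in>UNIV. S $ i $ j * (?u i)\<^sup>2)"
    by (simp add: doubly_stochasticD[OF S] flip: sum_distrib_right)
  also have "(\<Sum>j\<in>UNIV. (?v j)\<^sup>2) = (\<Sum>i\<in>UNIV. \<Sum>j\<in>UNIV. S $ i $ j * (?v j)\<^sup>2)"
    by (subst sum.swap) (simp add: doubly_stochasticD[OF S] flip: sum_distrib_right)
  finally show ?thesis
    by (simp add: power2_diff algebra_simps sum.distrib sum_subtractf sum_negf sum_distrib_left)
qed

theorem corollary1p1:
  fixes A :: "real^'n::finite^'n"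
    and W Z :: "real^('n + 'n)^('n + 'n)"
  assumes "connected_adjacency_matrix A"
    and "W = 2 *\<^sub>R block_matrix (mat 1) (- SK (A + mat 1)) (- SK (A + mat 1)) (mat 1)"
    and "Z = W"
  shows "has_support (A + mat 1) \<and>
    convergent (sinkhorn_knopp_seq (A + mat 1)) \<and>
    pos_semidef W \<and> pos_semidef Z \<and>
    Z \<succeq> W \<and>
    null_space W = span {vec 1} \<and>
    (\<forall>a. Z $ a $ a = 2) \<and>
    vec 1 \<bullet> (Z *v vec 1) = 0 \<and>
    two_block_adhere A Z W"
proof -
  have A01: "A $ i $ j \<in> {0, 1}" and A_sym: "A $ i $ j = A $ j $ i" for i j
    using assms(1) unfolding connected_adjacency_matrix_def
    by (blast, metis transpose_def vec_lambda_beta)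
  have A_nonneg: "0 \<le> A $ i $ j" for i j using A01[of i j] by auto
  let ?C = "A + mat 1"
  obtain T where "doubly_stochastic_pattern ?C T"
    using symmetric_pattern_doubly_stochastic[of A] A01 A_sym by blast
  then interpret doubly_stochastic_pattern ?C T .
  have "transpose ?C = ?C"
    by (simp add: transpose_def vec_eq_iff mat_def A_sym)
  then obtain S where lim: "M \<longlonglongrightarrow> S" and S: "doubly_stochastic S" "transpose S = S"
    and pos: "\<And>i j. 0 < S $ i $ j \<longleftrightarrow> 0 < ?C $ i $ j"
    using sinkhorn_knopp_symmetric_limit by blast
  have "SK ?C = S" unfolding SK_def using lim by (rule limI)
  with assms(2) have W: "W = 2 *\<^sub>R block_matrix (mat 1) (- S) (- S) (mat 1)" by simp
  have S_sym: "S $ i $ j = S $ j $ i" for i j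
    using S(2) by (metis transpose_def vec_lambda_beta)
  have S_nonneg: "0 \<le> S $ i $ j" for i j using S(1) by (rule doubly_stochasticD)
  have W_sym: "transpose W = W"
    unfolding W
    by (simp add: vec_eq_iff transpose_def block_matrix_def mat_def S_sym eq_commute
        split: sum.splits)
  have form: "x \<bullet> (W *v x) = 2 * (\<Sum>i\<in>UNIV. \<Sum>j\<in>UNIV. S $ i $ j * (x $ Inl i - x $ Inr j)\<^sup>2)"
    for x
    using bipartite_quadratic_form[OF S, of x]
    by (simp add: W scaleR_matrix_vector_assoc[symmetric])
  have W_psd: "pos_semidef W"
    unfolding pos_semidef_def form using W_sym S_nonneg by (auto intro!: sum_nonneg)
  have W_one: "W *v vec 1 = 0"
  proof -
    \<comment> \<open>In each row the identity block contributes 1 and the \<open>- S\<close> block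
      minus a unit row sum.\<close>
    have "(W *v vec 1) $ a = 0" for a
      by (cases a) (simp_all add: W matrix_vector_mult_def sum_UNIV_Plus block_matrix_def mat_def
          sum_negf doubly_stochasticD[OF S(1)] flip: sum_distrib_left)
    then show ?thesis by (simp add: vec_eq_iff)
  qed
  have "null_space W = span {vec 1}"
  proof
    show "span {vec 1} \<subseteq> null_space W"
      using W_one by (auto simp: span_singleton null_space_def matrix_vector_mult_scaleR)
    show "null_space W \<subseteq> span {vec 1}"
    proof
      fix x assume "x \<in> null_space W"
      then have "x \<bullet> (W *v x) = 0" by (simp add: null_space_def)
      then have "(\<Sum>i\<in>UNIV. \<Sum>j\<in>UNIV. S $ i $ j * (x $ Inl i - x $ Inr j)\<^sup>2) = 0"
        by (simp add: form)
      then have "S $ i $ j * (x $ Inl i - x $ Inr j)\<^sup>2 = 0" for i j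
        using S_nonneg by (simp add: sum_nonneg_eq_0_iff sum_nonneg)
      then have edge: "x $ Inl i = x $ Inr j" if "0 < ?C $ i $ j" for i j
        using that pos by (metis eq_iff_diff_eq_0 less_irrefl mult_eq_0_iff zero_eq_power2)
      \<comment> \<open>The added identity supplies an edge between the two copies of each
        node.\<close>
      have diag: "x $ Inr i = x $ Inl i" for i
        using edge[of i i] A_nonneg[of i i] by (simp add: mat_def)
      have "x $ Inl i = x $ Inl j" for i j
      proof (rule connected_adjacency_matrix_const[OF assms(1), of "\<lambda>i. x $ Inl i"])
        fix i j assume "A $ i $ j = 1"
        then show "x $ Inl i = x $ Inl j"
          using edge[of i j] diag[of j] by (simp add: mat_def)
      qed
      \<comment> \<open>\<open>undefined\<close> merely names some fixed reference node.\<close>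
      then have "x $ a = x $ Inl undefined" for a
        using diag by (cases a) metis+
      then have "x = (x $ Inl undefined) *\<^sub>R vec 1" by (simp add: vec_eq_iff)
      then show "x \<in> span {vec 1}" by (metis span_base span_scale singletonI)
    qed
  qed
  moreover have "W $ a $ a = 2" for a
    by (simp add: W block_matrix_def mat_def split: sum.splits)
  moreover have "two_block_adhere A W W"
  proof -
    \<comment> \<open>Off the diagonal \<open>A + mat 1\<close> agrees with \<open>A\<close>, and
      \<open>S\<close> has the same positive entries.\<close>
    have S0: "S $ i $ j = 0" "S $ j $ i = 0" if "i \<noteq> j" "A $ i $ j = 0" for i j
      using that pos[of i j] S_nonneg[of i j] S_sym[of i j] by (simp_all add: mat_def)
    then show ?thesis
      unfolding two_block_adhere_def
      \<comment> \<open>\<open>B = S\<close> fits both off-diagonal blocks because \<open>S\<close>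
        is its own transpose.\<close>
      by (intro conjI W_sym exI[of _ S])
        (auto simp: W S(2) block_matrix_def mat_def)
  qed
  moreover have "has_support ?C"
    using A_nonneg by (intro has_support_if_diagonal_pos) (simp add: mat_def add_nonneg_pos)
  moreover have "W \<succeq> W"
    by (simp add: loewner_ge_def pos_semidef_def transpose_def zero_vec_def
        matrix_vector_mult_def inner_vec_def)
  ultimately show ?thesis
    using lim W_psd W_one assms(3) by (auto simp: convergent_def)
qed

end
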